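(* Let $(X,d)$ be a nonempty compact metric space, let $E=\{\epsilon_n\}_{n\in\mathbb N}$ be a sequence of positive numbers with $\epsilon_n\to 0$, and let $\mathcal F$ be a non-proper ultrafilter over $\mathbb N$. Let $\mu_{E,\mathcal F}$ be the measure of complexity and $\nu_{E,\mathcal F}$ the dual measure of complexity of $(X,d)$. Suppose there exists $k\in\mathbb N$ such that for every $x\in X$ and every sufficiently small $\epsilon>0$ (i.e. all $0<\epsilon<\epsilon_0$ for some $\epsilon_0>0$ not depending on $x$) one has $C_\epsilon(O_\epsilon(x))\le k$. Then $\mu_{E,\mathcal F}$ and $\nu_{E,\mathcal F}$ are equivalent and, moreover, $$\frac1k\,\nu_{E,\mathcal F}(A)\le \mu_{E,\mathcal F}(A)\le k\,\nu_{E,\mathcal F}(A)$$ for every Borel set $A\subseteq X$.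
   Context: For $x\in X$ and $\epsilon>0$, $O_\epsilon(x)=\{y\in X: d(x,y)<\epsilon\}$; for $Y\subseteq X$, $O_\epsilon(Y)=\bigcup_{x\in Y}O_\epsilon(x)$. A set $Y\subseteq X$ is $\epsilon$-separated if $d(x,y)\ge\epsilon$ for all distinct $x,y\in Y$. For $D\subseteq X$, $C_\epsilon(D)$ is the maximal cardinality of an $\epsilon$-separated set contained in $D$; $C_\epsilon=C_\epsilon(X)$. An $\epsilon$-separated set $Y\subseteq X$ is optimal if $|Y|=C_\epsilon$. A set $Y\subseteq X$ is an $\epsilon$-net if $O_\epsilon(Y)=X$; $R_\epsilon$ is the minimal cardinality of an $\epsilon$-net in $X$, and an $\epsilon$-net $Y$ is optimal if $|Y|=R_\epsilon$. An ultrafilter $\mathcal F$ over $\mathbb N$ is non-proper if it contains no finite set (equivalently, it contains all cofinite sets). For a bounded real sequence $(a_n)$, $\lim_{\mathcal F}a_n$ is the unique $a\in\mathbb R$ such that $\{n: |a_n-a|<\delta\}\in\mathcal F$ for every $\delta>0$. Measure of complexity: for each $\epsilon>0$ choose an optimal $\epsilon$-separated set $A_\epsilon$ and put $I_\epsilon(\phi)=\frac1{C_\epsilon}\sum_{x\in A_\epsilon}\phi(x)$ for $\phi\in C(X)$ (continuous real functions), and $I(\phi)=\lim_{\mathcal F}I_{\epsilon_n}(\phi)$. $I$ is a positive bounded linear functional on $C(X)$ that does not depend on the choice of the sets $A_\epsilon$; $\mu_{E,\mathcal F}$ is the unique regular Borel probability measure with $I(\phi)=\int\phi\,d\mu_{E,\mathcal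 F}$ for all $\phi\in C(X)$. Dual measure of complexity: for each $\epsilon>0$ choose an optimal $\epsilon$-net $N_\epsilon$ and put $\tilde I_\epsilon(\phi)=\frac1{R_\epsilon}\sum_{x\in N_\epsilon}\phi(x)$ and $\tilde I(\phi)=\lim_{\mathcal F}\tilde I_{\epsilon_n}(\phi)$. $\tilde I$ is a positive bounded linear functional that does not depend on the choice of the sets $N_\epsilon$; $\nu_{E,\mathcal F}$ is the unique regular Borel probability measure with $\tilde I(\phi)=\int\phi\,d\nu_{E,\mathcal F}$ for all $\phi\in C(X)$. Two measures are equivalent if they have the same null sets. *)

theory Defs
  imports "HOL-Probability.Probability"
begin

text \<open>
  The compact metric space is a carrier set \<^term>\<open>X\<close> in a type of class \<^class>\<open>metric_space\<close>, with
  the restricted metric; all notions below are relative to \<^term>\<open>X\<close>.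
\<close>

definition O_ball :: "'a::metric_space set \<Rightarrow> real \<Rightarrow> 'a \<Rightarrow> 'a set" where
  "O_ball X \<epsilon> x = {y \<in> X. dist x y < \<epsilon>}"

definition O_nbhd :: "'a::metric_space set \<Rightarrow> real \<Rightarrow> 'a set \<Rightarrow> 'a set" where
  "O_nbhd X \<epsilon> Y = (\<Union>x\<in>Y. O_ball X \<epsilon> x)"

definition separated :: "real \<Rightarrow> 'a::metric_space set \<Rightarrow> bool" where
  "separated \<epsilon> Y \<longleftrightarrow> (\<forall>x\<in>Y. \<forall>y\<in>Y. x \<noteq> y \<longrightarrow> dist x y \<ge> \<epsilon>)"

text \<open>
  For \<open>\<epsilon> > 0\<close> and \<^term>\<open>D\<close> inside a compact set, every \<open>\<epsilon>\<close>-separated subset of \<^term>\<open>D\<close> is finite and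
  their cardinalities are bounded, so the maximum below is a genuine one.
\<close>

definition sep_number :: "real \<Rightarrow> 'a::metric_space set \<Rightarrow> nat" where
  "sep_number \<epsilon> D = Max {card Y | Y. Y \<subseteq> D \<and> finite Y \<and> separated \<epsilon> Y}"

definition optimal_separated :: "'a::metric_space set \<Rightarrow> real \<Rightarrow> 'a set \<Rightarrow> bool" where
  "optimal_separated X \<epsilon> Y \<longleftrightarrow>
     Y \<subseteq> X \<and> finite Y \<and> separated \<epsilon> Y \<and> card Y = sep_number \<epsilon> X"

definition eps_net :: "'a::metric_space set \<Rightarrow> real \<Rightarrow> 'a set \<Rightarrow> bool" where
  "eps_net X \<epsilon> Y \<longleftrightarrow> Y \<subseteq> X \<and> O_nbhd X \<epsilon> Y = X"

text \<open>
  Finiteness has to be required explicitly: infinite nets exist and \<^const>\<open>card\<close> sends them to 0.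
\<close>

definition net_number :: "'a::metric_space set \<Rightarrow> real \<Rightarrow> nat" where
  "net_number X \<epsilon> = (LEAST n. \<exists>Y. finite Y \<and> eps_net X \<epsilon> Y \<and> card Y = n)"

definition optimal_net :: "'a::metric_space set \<Rightarrow> real \<Rightarrow> 'a set \<Rightarrow> bool" where
  "optimal_net X \<epsilon> Y \<longleftrightarrow> finite Y \<and> eps_net X \<epsilon> Y \<and> card Y = net_number X \<epsilon>"

text \<open>
  Ultrafilters are represented by the library's filters: a set \<^term>\<open>S\<close> belongs to \<^term>\<open>F\<close> iff
  \<open>eventually (\<lambda>n. n \<in> S) F\<close>.  Then \<^term>\<open>Lim F a\<close> is the unique \<open>l\<close> such that
  \<open>{n. \<bar>a n - l\<bar> < \<delta>}\<close> belongs to \<^term>\<open>F\<close> for every \<open>\<delta> > 0\<close>.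
  ``Non-proper'' means non-principal.
\<close>

definition is_ultrafilter :: "'i filter \<Rightarrow> bool" where
  "is_ultrafilter F \<longleftrightarrow>
     F \<noteq> bot \<and> (\<forall>S. eventually (\<lambda>n. n \<in> S) F \<or> eventually (\<lambda>n. n \<notin> S) F)"

definition nonproper_ultrafilter :: "'i filter \<Rightarrow> bool" where
  "nonproper_ultrafilter F \<longleftrightarrow>
     is_ultrafilter F \<and> (\<forall>S. finite S \<longrightarrow> \<not> eventually (\<lambda>n. n \<in> S) F)"

definition regular_borel_prob :: "'a::metric_space set \<Rightarrow> 'a measure \<Rightarrow> bool" where
  "regular_borel_prob X M \<longleftrightarrow>
     prob_space M \<and> sets M = sets (restrict_space borel X) \<and>
     (\<forall>B\<in>sets M.
        emeasure M B = (SUP K\<in>{K. K \<subseteq> B \<and> compact K}. emeasure M K) \<and>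
        emeasure M B = (INF U\<in>{U. B \<subseteq> U \<and> openin (top_of_set X) U}. emeasure M U))"

definition complexity_functional ::
  "'a::metric_space set \<Rightarrow> (nat \<Rightarrow> real) \<Rightarrow> nat filter \<Rightarrow> (real \<Rightarrow> 'a set) \<Rightarrow> ('a \<Rightarrow> real) \<Rightarrow> real" where
  "complexity_functional X E F A \<phi> =
     Lim F (\<lambda>n. (1 / real (sep_number (E n) X)) * (\<Sum>x\<in>A (E n). \<phi> x))"

definition dual_complexity_functional ::
  "'a::metric_space set \<Rightarrow> (nat \<Rightarrow> real) \<Rightarrow> nat filter \<Rightarrow> (real \<Rightarrow> 'a set) \<Rightarrow> ('a \<Rightarrow> real) \<Rightarrow> real" where
  "dual_complexity_functional X E F N \<phi> =
     Lim F (\<lambda>n. (1 / real (net_number X (E n))) * (\<Sum>x\<in>N (E n). \<phi> x))"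

text \<open>
  The functionals do not depend on the choice of the optimal sets and each is represented by exactly
  one regular Borel probability measure, so the next two predicates describe a unique measure; the
  choice of optimal sets is existentially quantified.
\<close>

definition complexity_measure ::
  "'a::metric_space set \<Rightarrow> (nat \<Rightarrow> real) \<Rightarrow> nat filter \<Rightarrow> 'a measure \<Rightarrow> bool" where
  "complexity_measure X E F \<mu> \<longleftrightarrow>
     regular_borel_prob X \<mu> \<and>
     (\<exists>A. (\<forall>\<epsilon>>0. optimal_separated X \<epsilon> (A \<epsilon>)) \<and>
          (\<forall>\<phi>. continuous_on X \<phi> \<longrightarrow> complexity_functional X E F A \<phi> = (\<integral>x. \<phi> x \<partial>\<mu>)))"

definition dual_complexity_measure ::
  "'a::metric_space set \<Rightarrow> (nat \<Rightarrow> real) \<Rightarrow> nat filter \<Rightarrow> 'a measure \<Rightarrow> bool" where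
  "dual_complexity_measure X E F \<nu> \<longleftrightarrow>
     regular_borel_prob X \<nu> \<and>
     (\<exists>N. (\<forall>\<epsilon>>0. optimal_net X \<epsilon> (N \<epsilon>)) \<and>
          (\<forall>\<phi>. continuous_on X \<phi> \<longrightarrow> dual_complexity_functional X E F N \<phi> = (\<integral>x. \<phi> x \<partial>\<nu>)))"

definition equivalent_measures :: "'a measure \<Rightarrow> 'a measure \<Rightarrow> bool" where
  "equivalent_measures \<mu> \<nu> \<longleftrightarrow> null_sets \<mu> = null_sets \<nu>"

end

theory Submission
  imports Defs
begin

text \<open>
  Write \<open>A\<close> for an optimal \<open>\<epsilon>\<close>-separated set, \<open>N\<close> for an optimal \<open>\<epsilon>\<close>-net, \<open>C = |A|\<close> and \<open>R = |N|\<close>.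
  Both measures are limits of normalised counting measures, so the theorem reduces to comparing the
  number of points of \<open>A\<close> and of \<open>N\<close> near a given set \<open>S\<close>.

  Each point of \<open>A\<close> in \<open>S\<close> is within \<open>\<epsilon>\<close> of a point of \<open>N\<close>, and the \<open>\<epsilon>\<close>-ball about a point of \<open>N\<close>
  contains at most \<open>k\<close> points of \<open>A\<close>, by the hypothesis on balls.  Hence \<open>A\<close> has at most \<open>k\<close> times as
  many points in \<open>S\<close> as \<open>N\<close> has near \<open>S\<close> (\<open>card_separated_le_net\<close>); with \<open>S\<close> the whole space this
  gives \<open>C \<le> k R\<close>.  In the other direction, \<open>A\<close> is itself an \<open>\<epsilon>\<close>-net by maximality, so \<open>R \<le> C\<close>.
  Moreover the points of \<open>N\<close> in \<open>S\<close> may be exchanged for the points of \<open>A\<close> within \<open>2\<epsilon>\<close> of \<open>S\<close> without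
  losing the covering property, so minimality of \<open>N\<close> shows that \<open>N\<close> has at most as many points in \<open>S\<close>
  as \<open>A\<close> has near \<open>S\<close> (\<open>card_optimal_net_le_net\<close>).  After normalisation, \<open>R \<le> C\<close> preserves the first
  comparison, and \<open>C \<le> k R\<close> turns the second one into a comparison with the factor \<open>k\<close>.

  A comparison of normalised counts that tolerates an arbitrarily small enlargement of \<open>S\<close> passes to
  the limit measures (\<open>measure_le_if_counting_le\<close>): squeeze the counts between continuous functions
  near a compact set \<open>K\<close>, shrink the neighbourhoods of \<open>K\<close>, and use inner regularity to reach every
  Borel set.  The two resulting inequalities between the measures also identify their null sets.
\<close>

section \<open>Separated sets and nets at a fixed scale\<close>

text \<open>
  A ball of radius \<open>\<epsilon>/2\<close> contains at most one point of an \<open>\<epsilon>\<close>-separated set, so the size of a finite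
  cover of \<^term>\<open>X\<close> by such balls bounds all these cardinalities.  This makes the maximum defining
  \<^const>\<open>sep_number\<close> meaningful.
\<close>

lemma finite_sep_cardinalities:
  assumes "compact X" "\<epsilon> > 0" "D \<subseteq> X"
  shows "finite {card Y | Y. Y \<subseteq> D \<and> finite Y \<and> separated \<epsilon> Y}"
proof -
  obtain Z where Z: "finite Z" "X \<subseteq> (\<Union>z\<in>Z. ball z (\<epsilon>/2))"
  proof (rule compactE_image[OF assms(1), of X "\<lambda>z. ball z (\<epsilon>/2)"])
    show "X \<subseteq> (\<Union>z\<in>X. ball z (\<epsilon>/2))" using assms(2) by force
  qed (use that in auto)
  have "card Y \<le> card Z" if Y: "Y \<subseteq> D" "separated \<epsilon> Y" for Y
  proof -
    have "\<forall>y\<in>Y. \<exists>z\<in>Z. dist z y < \<epsilon>/2"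
      using Y(1) assms(3) Z(2) by (force simp: subset_iff)
    then obtain f where f: "\<And>y. y \<in> Y \<Longrightarrow> f y \<in> Z \<and> dist (f y) y < \<epsilon>/2"
      by metis
    have "inj_on f Y"
    proof (rule inj_onI, rule ccontr)
      fix x y assume xy: "x \<in> Y" "y \<in> Y" "f x = f y" "x \<noteq> y"
      have "dist x y < \<epsilon>"
        using f[OF xy(1)] f[OF xy(2)] xy(3) dist_triangle_half_r[of "f x" x \<epsilon> y] by simp
      then show False using Y(2) xy unfolding separated_def by force
    qed
    then show ?thesis using f Z(1) by (intro card_inj_on_le[of f]) auto
  qed
  then show ?thesis by (intro finite_subset[OF _ finite_atMost[of "card Z"]]) auto
qed

lemma card_separated_le_sep_number:
  assumes "compact X" "\<epsilon> > 0" "D \<subseteq> X" "Y \<subseteq> D" "finite Y" "separated \<epsilon> Y"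
  shows "card Y \<le> sep_number \<epsilon> D"
  unfolding sep_number_def
  using finite_sep_cardinalities[OF assms(1-3)] assms(4-) by (intro Max_ge) auto

text \<open>
  A point at distance at least \<open>\<epsilon>\<close> from all of \<^term>\<open>A\<close> could be added to \<^term>\<open>A\<close>, contradicting
  its maximal cardinality.
\<close>

lemma optimal_separated_is_net:
  assumes "compact X" "\<epsilon> > 0" "optimal_separated X \<epsilon> A"
  shows "eps_net X \<epsilon> A"
proof -
  have A: "A \<subseteq> X" "finite A" "separated \<epsilon> A" "card A = sep_number \<epsilon> X"
    using assms(3) by (auto simp: optimal_separated_def)
  have "\<exists>x\<in>A. dist x y < \<epsilon>" if y: "y \<in> X" for y
  proof (rule ccontr)
    assume far: "\<not> ?thesis"
    then have "y \<notin> A" using assms(2) by auto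
    moreover have "separated \<epsilon> (insert y A)"
      using far A(3) by (auto simp: separated_def not_less dist_commute)
    then have "card (insert y A) \<le> card A"
      using card_separated_le_sep_number[OF assms(1,2) order_refl, of "insert y A"] A y by simp
    ultimately show False using A(2) by simp
  qed
  then show ?thesis using A(1) by (auto simp: eps_net_def O_nbhd_def O_ball_def)
qed

lemma net_number_le_card:
  assumes "finite Y" "eps_net X \<epsilon> Y"
  shows "net_number X \<epsilon> \<le> card Y"
  unfolding net_number_def using assms by (intro Least_le) auto

text \<open>
  Send each point of \<open>A \<inter> S\<close> to a net point closer than \<open>\<epsilon>\<close>.  The points sent to the same \<^term>\<open>y\<close> form
  an \<open>\<epsilon>\<close>-separated subset of the \<open>\<epsilon>\<close>-ball about \<^term>\<open>y\<close>, so there are at most \<^term>\<open>k\<close> of them.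
\<close>

lemma card_separated_le_net:
  assumes "compact X" "\<epsilon> > 0" "A \<subseteq> X" "finite A" "separated \<epsilon> A"
    and "finite N" "eps_net X \<epsilon> N"
    and k: "\<And>x. x \<in> X \<Longrightarrow> sep_number \<epsilon> (O_ball X \<epsilon> x) \<le> k"
  shows "card (A \<inter> S) \<le> k * card {y \<in> N. \<exists>x\<in>S. dist x y < \<epsilon>}"
proof -
  define T where "T = {y \<in> N. \<exists>x\<in>S. dist x y < \<epsilon>}"
  have T: "finite T" "T \<subseteq> X" using assms(6,7) by (auto simp: T_def eps_net_def)
  have "A \<inter> S \<subseteq> (\<Union>y\<in>T. A \<inter> O_ball X \<epsilon> y)"
  proof
    fix x assume x: "x \<in> A \<inter> S"
    then have "x \<in> O_nbhd X \<epsilon> N" using assms(3,7) by (auto simp: eps_net_def)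
    then obtain y where y: "y \<in> N" "x \<in> O_ball X \<epsilon> y" by (auto simp: O_nbhd_def)
    then have "dist x y < \<epsilon>" by (simp add: O_ball_def dist_commute)
    then show "x \<in> (\<Union>y\<in>T. A \<inter> O_ball X \<epsilon> y)"
      using x y by (auto simp: T_def)
  qed
  then have "card (A \<inter> S) \<le> card (\<Union>y\<in>T. A \<inter> O_ball X \<epsilon> y)"
    using T assms(4) by (intro card_mono) auto
  also have "\<dots> \<le> (\<Sum>y\<in>T. card (A \<inter> O_ball X \<epsilon> y))"
    using T by (intro card_UN_le)
  also have "\<dots> \<le> (\<Sum>y\<in>T. k)"
  proof (rule sum_mono)
    fix y assume "y \<in> T"
    then have "sep_number \<epsilon> (O_ball X \<epsilon> y) \<le> k" using T k by auto
    moreover have "card (A \<inter> O_ball X \<epsilon> y) \<le> sep_number \<epsilon> (O_ball X \<epsilon> y)"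
      using assms(4,5)
      by (intro card_separated_le_sep_number[OF assms(1,2)])
         (auto simp: O_ball_def separated_def)
    ultimately show "card (A \<inter> O_ball X \<epsilon> y) \<le> k" by simp
  qed
  also have "\<dots> = k * card T" by simp
  finally show ?thesis unfolding T_def .
qed

text \<open>
  An exchange argument: remove from \<^term>\<open>N\<close> its points in \<^term>\<open>S\<close> and insert the points of \<^term>\<open>M\<close>
  within \<open>2\<epsilon>\<close> of \<^term>\<open>S\<close>.  A point that had been covered from \<^term>\<open>S\<close> is covered by some point of
  \<^term>\<open>M\<close>, which is one of the inserted points by the triangle inequality.  So the result is again a
  net, and it cannot be smaller than \<^term>\<open>N\<close>.
\<close>

lemma card_optimal_net_le_net:
  assumes "optimal_net X \<epsilon> N" "finite M" "eps_net X \<epsilon> M"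
  shows "card (N \<inter> S) \<le> card {y \<in> M. \<exists>x\<in>S. dist x y < 2 * \<epsilon>}"
proof -
  define T where "T = {y \<in> M. \<exists>x\<in>S. dist x y < 2 * \<epsilon>}"
  have N: "finite N" "eps_net X \<epsilon> N" "card N = net_number X \<epsilon>"
    using assms(1) by (auto simp: optimal_net_def)
  have "X \<subseteq> O_nbhd X \<epsilon> ((N - S) \<union> T)"
  proof
    fix z assume z: "z \<in> X"
    then obtain x y where xy: "x \<in> N" "dist x z < \<epsilon>" "y \<in> M" "dist y z < \<epsilon>"
      using N(2) assms(3) by (fastforce simp: eps_net_def O_nbhd_def O_ball_def)
    have "dist x y < 2 * \<epsilon>"
      using dist_triangle2[of x y z] xy by simp
    then have "x \<in> S \<Longrightarrow> y \<in> T" using xy by (auto simp: T_def)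
    then show "z \<in> O_nbhd X \<epsilon> ((N - S) \<union> T)"
      using xy z by (auto simp: O_nbhd_def O_ball_def)
  qed
  then have "eps_net X \<epsilon> ((N - S) \<union> T)"
    using N(2) assms(3) by (auto simp: eps_net_def O_nbhd_def O_ball_def T_def)
  then have "card N \<le> card ((N - S) \<union> T)"
    using N(1,3) assms(2) net_number_le_card[of "(N - S) \<union> T" X \<epsilon>] by (simp add: T_def)
  also have "\<dots> \<le> card (N - S) + card T" by (rule card_Un_le)
  finally have "card (N \<inter> S) \<le> card T"
    using card_Int_Diff[OF N(1), of S] by simp
  then show ?thesis unfolding T_def .
qed

section \<open>Limits along an ultrafilter\<close>

lemma ultrafilter_cases:
  assumes "is_ultrafilter F"
  shows "eventually P F \<or> eventually (\<lambda>n. \<not> P n) F"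
  using assms[unfolded is_ultrafilter_def, THEN conjunct2, rule_format, of "Collect P"] by simp

text \<open>
  By compactness of \<open>{-B..B}\<close> the values have a cluster point along \<^term>\<open>F\<close>; along an ultrafilter a
  cluster point is a limit.
\<close>

lemma ultrafilter_tendsto_Lim:
  fixes f :: "'i \<Rightarrow> real"
  assumes "is_ultrafilter F" "\<And>n. \<bar>f n\<bar> \<le> B"
  shows "(f \<longlongrightarrow> Lim F f) F"
proof -
  have F: "F \<noteq> bot" using assms(1) by (simp add: is_ultrafilter_def)
  have "filtermap f F \<noteq> bot" using F by (simp add: filtermap_bot_iff)
  moreover have "eventually (\<lambda>x. x \<in> {-B..B}) (filtermap f F)"
    using assms(2) by (auto simp: eventually_filtermap abs_le_iff minus_le_iff intro!: always_eventually)
  ultimately obtain l where l: "inf (nhds l) (filtermap f F) \<noteq> bot"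
    using compact_Icc[of "-B" B] unfolding compact_filter by blast
  have "(f \<longlongrightarrow> l) F"
  proof (rule topological_tendstoI)
    fix S assume S: "open S" "l \<in> S"
    show "eventually (\<lambda>n. f n \<in> S) F"
    proof (rule ccontr)
      assume "\<not> ?thesis"
      then have "eventually (\<lambda>n. f n \<notin> S) F"
        using assms(1) ultrafilter_cases[of F "\<lambda>n. f n \<in> S"] by blast
      then have "eventually (\<lambda>x. x \<notin> S) (filtermap f F)" by (simp add: eventually_filtermap)
      moreover have "eventually (\<lambda>x. x \<in> S) (nhds l)" using S eventually_nhds by blast
      ultimately have "eventually (\<lambda>_. False) (inf (nhds l) (filtermap f F))"
        unfolding eventually_inf by blast
      then show False using l by (simp add: trivial_limit_def)
    qed
  qed
  then show ?thesis using tendsto_Lim[OF F, of f l] by simp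
qed

text \<open>
  So whatever holds for all small scales holds \<^term>\<open>F\<close>-eventually along a sequence of scales
  tending to \<open>0\<close>.
\<close>

lemma nonproper_ultrafilter_le_sequentially:
  assumes "nonproper_ultrafilter F"
  shows "F \<le> sequentially"
proof (rule filter_leI)
  fix P :: "nat \<Rightarrow> bool" assume "eventually P sequentially"
  then have "finite {n. \<not> P n}" by (simp add: eventually_cofinite flip: cofinite_eq_sequentially)
  then have "\<not> eventually (\<lambda>n. n \<in> {n. \<not> P n}) F"
    using assms unfolding nonproper_ultrafilter_def by blast
  moreover have "is_ultrafilter F" using assms by (simp add: nonproper_ultrafilter_def)
  ultimately show "eventually P F"
    using ultrafilter_cases[of F P] by simp
qed

text \<open>
  This says that the limits in \<^const>\<open>complexity_functional\<close> and \<^const>\<open>dual_complexity_functional\<close>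
  are attained, so that inequalities between averages pass to the integrals.
\<close>

lemma tendsto_Lim_averages:
  fixes P :: "nat \<Rightarrow> 'a::metric_space set"
  assumes "compact X" "is_ultrafilter F" "continuous_on X \<phi>" "\<And>n. P n \<subseteq> X"
  defines "avg \<equiv> \<lambda>n. (1 / real (card (P n))) * (\<Sum>x\<in>P n. \<phi> x)"
  shows "(avg \<longlongrightarrow> Lim F avg) F"
proof -
  have "bounded (\<phi> ` X)"
    using assms(1,3) by (intro compact_imp_bounded compact_continuous_image)
  then obtain B where B: "\<And>x. x \<in> X \<Longrightarrow> \<bar>\<phi> x\<bar> \<le> B" "B > 0"
    unfolding bounded_pos by auto
  show ?thesis
  proof (rule ultrafilter_tendsto_Lim[OF assms(2)])
    fix n
    have "\<bar>\<Sum>x\<in>P n. \<phi> x\<bar> \<le> (\<Sum>x\<in>P n. \<bar>\<phi> x\<bar>)" by (rule sum_abs)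
    also have "\<dots> \<le> (\<Sum>x\<in>P n. B)" using assms(4) B by (intro sum_mono) auto
    finally show "\<bar>avg n\<bar> \<le> B"
      using B(2) by (cases "card (P n) = 0") (auto simp: avg_def abs_mult field_simps)
  qed
qed

section \<open>From counting to measures\<close>

text \<open>
  For \<open>\<delta> > 0\<close>, a continuous function with values in \<open>[0, 1]\<close> that lies between the indicators of the neighbourhoods
  of \<^term>\<open>K\<close> of radii \<open>s \<delta>\<close> and \<open>(s + 1) \<delta>\<close>.  The values \<open>s = 0\<close> and \<open>s = 2\<close> are used below, which
  leaves the gap between \<open>\<delta>\<close> and \<open>2 \<delta>\<close> for moving points by less than \<open>\<delta>\<close>.
\<close>

definition plateau :: "'a::metric_space set \<Rightarrow> real \<Rightarrow> real \<Rightarrow> 'a \<Rightarrow> real" where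
  "plateau K \<delta> s x = min 1 (max 0 (s + 1 - infdist x K / \<delta>))"

lemma continuous_on_plateau: "continuous_on X (plateau K \<delta> s)"
  unfolding plateau_def divide_inverse
  by (intro continuous_on_min continuous_on_max continuous_on_diff continuous_on_mult
      continuous_on_infdist continuous_on_const continuous_on_id)

lemma plateau_bounds: "0 \<le> plateau K \<delta> s x" "plateau K \<delta> s x \<le> 1"
  by (auto simp: plateau_def)

lemma plateau_eq_1: "\<delta> > 0 \<Longrightarrow> infdist x K \<le> s * \<delta> \<Longrightarrow> plateau K \<delta> s x = 1"
  using pos_divide_le_eq[of \<delta> "infdist x K" s] by (simp add: plateau_def)

lemma plateau_eq_0: "\<delta> > 0 \<Longrightarrow> infdist x K \<ge> (s + 1) * \<delta> \<Longrightarrow> plateau K \<delta> s x = 0"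
  by (simp add: plateau_def pos_le_divide_eq)

lemma plateau_le_indicator:
  assumes "\<delta> > 0"
  shows "plateau K \<delta> s x \<le> indicator {x. infdist x K < (s + 1) * \<delta>} x"
  using plateau_bounds[of K \<delta> s x] plateau_eq_0[OF assms, of s x K]
  by (auto simp: indicator_def not_less)

lemma regular_borel_prob_plateau_integral:
  assumes M: "regular_borel_prob X M" and "\<delta> > 0"
  shows "measure M {x\<in>X. infdist x K \<le> s * \<delta>} \<le> (\<integral>x. plateau K \<delta> s x \<partial>M)" (is ?lower)
    and "(\<integral>x. plateau K \<delta> s x \<partial>M) \<le> measure M {x\<in>X. infdist x K < (s + 1) * \<delta>}" (is ?upper)
proof -
  interpret prob_space M using M by (simp add: regular_borel_prob_def)
  have sets: "sets M = sets (restrict_space borel X)"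
    using M by (simp add: regular_borel_prob_def)
  then have space: "space M = X" using sets_eq_imp_space_eq[OF sets] by (simp add: space_restrict_space)
  have [measurable]: "plateau K \<delta> s \<in> borel_measurable M" "(\<lambda>x. infdist x K) \<in> borel_measurable M"
    unfolding measurable_cong_sets[OF sets refl]
    by (intro measurable_restrict_space1 borel_measurable_continuous_onI continuous_on_plateau
        continuous_intros)+
  have int: "integrable M (plateau K \<delta> s)"
    by (intro integrable_const_bound[of _ 1]) (simp_all add: plateau_bounds abs_of_nonneg)
  have [measurable]: "{x\<in>X. infdist x K \<le> s * \<delta>} \<in> sets M" "{x\<in>X. infdist x K < (s + 1) * \<delta>} \<in> sets M"
    unfolding space[symmetric] by measurable
  have int_indicator: "integrable M (indicator S :: 'a \<Rightarrow> real)" if "S \<in> sets M" for S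
    using that by (simp add: emeasure_eq_measure)
  have "measure M {x\<in>X. infdist x K \<le> s * \<delta>} = (\<integral>x. indicator {x\<in>X. infdist x K \<le> s * \<delta>} x \<partial>M)"
    by simp
  also have "\<dots> \<le> (\<integral>x. plateau K \<delta> s x \<partial>M)"
  proof (intro integral_mono int int_indicator)
    fix x
    show "indicator {x\<in>X. infdist x K \<le> s * \<delta>} x \<le> plateau K \<delta> s x"
      using plateau_eq_1[OF assms(2), of x K s] plateau_bounds(1)[of K \<delta> s x]
      by (cases "infdist x K \<le> s * \<delta>") (simp_all add: indicator_def)
  qed measurable
  finally show ?lower .
  have "(\<integral>x. plateau K \<delta> s x \<partial>M) \<le> (\<integral>x. indicator {x\<in>X. infdist x K < (s + 1) * \<delta>} x \<partial>M)"
  proof (intro integral_mono int int_indicator)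
    fix x assume "x \<in> space M"
    then show "plateau K \<delta> s x \<le> indicator {x\<in>X. infdist x K < (s + 1) * \<delta>} x"
      using plateau_le_indicator[OF assms(2), of K s x] by (simp add: space indicator_def)
  qed measurable
  also have "\<dots> = measure M {x\<in>X. infdist x K < (s + 1) * \<delta>}" by simp
  finally show ?upper .
qed

text \<open>
  A closed set is the decreasing intersection of its metric neighbourhoods, so this is continuity of
  \<^term>\<open>M\<close> from above.
\<close>

lemma regular_borel_prob_tendsto_nbhd:
  assumes M: "regular_borel_prob X M" and K: "compact K" "K \<subseteq> X" "K \<noteq> {}" and c: "c > 0"
  shows "(\<lambda>n. measure M {x\<in>X. infdist x K < c / real (Suc n)}) \<longlonglongrightarrow> measure M K"
proof -
  interpret prob_space M using M by (simp add: regular_borel_prob_def)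
  have sets: "sets M = sets (restrict_space borel X)"
    using M by (simp add: regular_borel_prob_def)
  then have space: "space M = X" using sets_eq_imp_space_eq[OF sets] by (simp add: space_restrict_space)
  have [measurable]: "(\<lambda>x. infdist x K) \<in> borel_measurable M"
    unfolding measurable_cong_sets[OF sets refl]
    by (intro measurable_restrict_space1 borel_measurable_continuous_onI continuous_intros)
  let ?U = "\<lambda>n. {x\<in>X. infdist x K < c / real (Suc n)}"
  have "(\<Inter>n. ?U n) = K"
  proof
    show "K \<subseteq> (\<Inter>n. ?U n)" using K c by auto
    show "(\<Inter>n. ?U n) \<subseteq> K"
    proof
      fix x assume x: "x \<in> (\<Inter>n. ?U n)"
      have "(\<lambda>n. c / real (Suc n)) \<longlonglongrightarrow> 0"
        using LIMSEQ_Suc[OF lim_const_over_n[of c]] by simp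
      then have "infdist x K \<le> 0"
        by (rule LIMSEQ_le_const) (use x in \<open>auto intro!: less_imp_le\<close>)
      then have "infdist x K = 0" using infdist_nonneg[of x K] by linarith
      then show "x \<in> K" using K in_closed_iff_infdist_zero compact_imp_closed by blast
    qed
  qed
  moreover have "range ?U \<subseteq> sets M" unfolding space[symmetric] by (auto; measurable)
  moreover have "decseq ?U"
  proof (rule antimonoI)
    fix m n :: nat assume "m \<le> n"
    then have "c / real (Suc n) \<le> c / real (Suc m)" using c by (intro divide_left_mono) auto
    then show "?U n \<subseteq> ?U m" by auto
  qed
  ultimately show ?thesis using finite_Lim_measure_decseq[of ?U] by simp
qed

text \<open>
  Let \<^term>\<open>K\<close> be compact and \<open>\<delta> > 0\<close>.  A plateau function equal to \<open>1\<close> on \<^term>\<open>K\<close> and vanishing at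
  distance at least \<open>\<delta>\<close> is bounded by the indicator of a set \<^term>\<open>S\<close>, to which the counting hypothesis
  applies; the points within \<open>\<delta>\<close> of \<^term>\<open>S\<close> lie within \<open>2 \<delta>\<close> of \<^term>\<open>K\<close>, where a second, wider plateau
  function is \<open>1\<close>.  In the limit along \<^term>\<open>F\<close> the measure \<^term>\<open>M\<close> of \<^term>\<open>K\<close> is at most
  \<^term>\<open>c\<close> times the measure \<^term>\<open>M'\<close> of the \<open>3 \<delta>\<close>-neighbourhood.  Letting \<open>\<delta>\<close> tend to \<open>0\<close> gives the
  claim for compact sets, and inner regularity of \<^term>\<open>M\<close> extends it to all measurable sets.  Making
  the hypothesis hold for every \<open>\<delta>\<close>, but only eventually, absorbs the displacement by a multiple of
  \<open>\<epsilon>\<close> that matching one finite set with the other involves.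
\<close>

lemma measure_le_if_counting_le:
  fixes P Q :: "nat \<Rightarrow> 'a::metric_space set" and c :: real
  assumes M: "regular_borel_prob X M" and M': "regular_borel_prob X M'"
    and F: "F \<noteq> bot" and c: "c \<ge> 0"
    and limP: "\<And>\<phi>. continuous_on X \<phi> \<Longrightarrow>
      ((\<lambda>n. (1 / real (card (P n))) * (\<Sum>x\<in>P n. \<phi> x)) \<longlongrightarrow> (\<integral>x. \<phi> x \<partial>M)) F"
    and limQ: "\<And>\<phi>. continuous_on X \<phi> \<Longrightarrow>
      ((\<lambda>n. (1 / real (card (Q n))) * (\<Sum>x\<in>Q n. \<phi> x)) \<longlongrightarrow> (\<integral>x. \<phi> x \<partial>M')) F"
    and fin: "\<And>n. finite (P n)" "\<And>n. finite (Q n)"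
    and count: "\<And>S \<delta>. \<delta> > 0 \<Longrightarrow> eventually (\<lambda>n.
      real (card (P n \<inter> S)) / real (card (P n))
        \<le> c * (real (card {y \<in> Q n. \<exists>x\<in>S. dist x y < \<delta>}) / real (card (Q n)))) F"
    and B: "B \<in> sets M"
  shows "measure M B \<le> c * measure M' B"
proof -
  interpret M: prob_space M using M by (simp add: regular_borel_prob_def)
  interpret M': prob_space M' using M' by (simp add: regular_borel_prob_def)
  have sets: "sets M = sets M'" using M M' by (simp add: regular_borel_prob_def)
  have space: "space M = X"
    using M sets_eq_imp_space_eq[of M "restrict_space borel X"]
    by (simp add: regular_borel_prob_def space_restrict_space)
  have nbhd: "measure M K \<le> c * measure M' {x\<in>X. infdist x K < 3 * \<delta>}"
    if K: "K \<subseteq> X" "K \<noteq> {}" "closed K" and "\<delta> > 0" for K \<delta>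
  proof -
    define S where "S = {x. infdist x K < \<delta>}"
    have "measure M K \<le> measure M {x\<in>X. infdist x K \<le> 0 * \<delta>}"
    proof (rule M.finite_measure_mono)
      show "K \<subseteq> {x\<in>X. infdist x K \<le> 0 * \<delta>}" using K by auto
      have "{x\<in>X. infdist x K \<le> 0 * \<delta>} = X \<inter> {x. infdist x K \<le> 0 * \<delta>}" by auto
      moreover have "closed {x. infdist x K \<le> 0 * \<delta>}"
        by (intro closed_Collect_le continuous_intros)
      ultimately show "{x\<in>X. infdist x K \<le> 0 * \<delta>} \<in> sets M"
        using M by (auto simp: regular_borel_prob_def sets_restrict_space)
    qed
    also have "\<dots> \<le> (\<integral>x. plateau K \<delta> 0 x \<partial>M)"
      by (rule regular_borel_prob_plateau_integral(1)[OF M \<open>\<delta> > 0\<close>])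
    also have "\<dots> \<le> c * (\<integral>x. plateau K \<delta> 2 x \<partial>M')"
    proof (rule tendsto_le[OF F])
      show "((\<lambda>n. (1 / real (card (P n))) * (\<Sum>x\<in>P n. plateau K \<delta> 0 x)) \<longlongrightarrow> (\<integral>x. plateau K \<delta> 0 x \<partial>M)) F"
        by (intro limP continuous_on_plateau)
      show "((\<lambda>n. c * ((1 / real (card (Q n))) * (\<Sum>x\<in>Q n. plateau K \<delta> 2 x)))
          \<longlongrightarrow> c * (\<integral>x. plateau K \<delta> 2 x \<partial>M')) F"
        by (intro tendsto_mult_left limQ continuous_on_plateau)
      show "eventually (\<lambda>n. (1 / real (card (P n))) * (\<Sum>x\<in>P n. plateau K \<delta> 0 x)
          \<le> c * ((1 / real (card (Q n))) * (\<Sum>x\<in>Q n. plateau K \<delta> 2 x))) F"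
        using count[OF \<open>\<delta> > 0\<close>, of S]
      proof eventually_elim
        case (elim n)
        have "(\<Sum>x\<in>P n. plateau K \<delta> 0 x) \<le> (\<Sum>x\<in>P n. indicator S x)"
          using plateau_le_indicator[OF \<open>\<delta> > 0\<close>, of K 0] by (intro sum_mono) (simp add: S_def)
        also have "\<dots> = real (card (P n \<inter> S))"
          using fin by (simp add: indicator_def sum.If_cases Int_def flip: of_nat_sum)
        finally have "(1 / real (card (P n))) * (\<Sum>x\<in>P n. plateau K \<delta> 0 x)
            \<le> real (card (P n \<inter> S)) / real (card (P n))"
          by (simp add: divide_right_mono)
        also note elim
        also have "real (card {y \<in> Q n. \<exists>x\<in>S. dist x y < \<delta>}) \<le> (\<Sum>x\<in>Q n. plateau K \<delta> 2 x)"
        proof -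
          let ?T = "{y \<in> Q n. \<exists>x\<in>S. dist x y < \<delta>}"
          have "plateau K \<delta> 2 y = 1" if "y \<in> ?T" for y
          proof (rule plateau_eq_1[OF \<open>\<delta> > 0\<close>])
            obtain x where "infdist x K < \<delta>" "dist x y < \<delta>" using \<open>y \<in> ?T\<close> by (auto simp: S_def)
            then show "infdist y K \<le> 2 * \<delta>"
              using infdist_triangle[of y K x] by (simp add: dist_commute)
          qed
          then have "real (card ?T) = (\<Sum>y\<in>?T. plateau K \<delta> 2 y)" by simp
          also have "\<dots> \<le> (\<Sum>y\<in>Q n. plateau K \<delta> 2 y)"
            using fin plateau_bounds by (intro sum_mono2) auto
          finally show ?thesis .
        qed
        finally show ?case
          using c by (simp add: divide_right_mono mult_left_mono)
      qed
    qed
    also have "\<dots> \<le> c * measure M' {x\<in>X. infdist x K < 3 * \<delta>}"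
      using regular_borel_prob_plateau_integral(2)[OF M' \<open>\<delta> > 0\<close>, of K 2] c
      by (intro mult_left_mono) auto
    finally show ?thesis .
  qed
  have compact_le: "measure M K \<le> c * measure M' K" if K: "compact K" "K \<subseteq> X" for K
  proof (cases "K = {}")
    case False
    have "(\<lambda>n. c * measure M' {x\<in>X. infdist x K < 3 / real (Suc n)}) \<longlonglongrightarrow> c * measure M' K"
      by (intro tendsto_mult_left regular_borel_prob_tendsto_nbhd[OF M' K False]) simp
    moreover have "measure M K \<le> c * measure M' {x\<in>X. infdist x K < 3 / real (Suc n)}" for n
      using nbhd[of K "1 / real (Suc n)"] K False compact_imp_closed[OF K(1)] by simp
    ultimately show ?thesis by (intro LIMSEQ_le_const) auto
  qed auto
  have BX: "B \<subseteq> X" using sets.sets_into_space[OF B] space by simp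
  have "emeasure M B = (SUP K\<in>{K. K \<subseteq> B \<and> compact K}. emeasure M K)"
    using M B by (auto simp: regular_borel_prob_def)
  also have "\<dots> \<le> ennreal (c * measure M' B)"
  proof (rule SUP_least)
    fix K assume K: "K \<in> {K. K \<subseteq> B \<and> compact K}"
    then have "measure M K \<le> c * measure M' K" using BX compact_le by auto
    also have "\<dots> \<le> c * measure M' B"
      using K B sets c by (intro mult_left_mono M'.finite_measure_mono) auto
    finally show "emeasure M K \<le> ennreal (c * measure M' B)"
      by (simp add: M.emeasure_eq_measure ennreal_leI)
  qed
  finally show ?thesis using c by (simp add: M.emeasure_eq_measure)
qed

section \<open>Comparison of the two measures of complexity\<close>

theorem theorem6:
  fixes X :: "'a::metric_space set"
    and E :: "nat \<Rightarrow> real"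
    and F :: "nat filter"
    and \<mu> \<nu> :: "'a measure"
    and k :: nat
  assumes "compact X" and "X \<noteq> {}"
    and "\<And>n. E n > 0" and "E \<longlonglongrightarrow> 0"
    and "nonproper_ultrafilter F"
    and "complexity_measure X E F \<mu>"
    and "dual_complexity_measure X E F \<nu>"
    and "\<exists>\<epsilon>\<^sub>0>0. \<forall>x\<in>X. \<forall>\<epsilon>. 0 < \<epsilon> \<and> \<epsilon> < \<epsilon>\<^sub>0 \<longrightarrow> sep_number \<epsilon> (O_ball X \<epsilon> x) \<le> k"
  shows "equivalent_measures \<mu> \<nu> \<and>
    (\<forall>A. A \<in> sets borel \<and> A \<subseteq> X \<longrightarrow>
       1 / real k * measure \<nu> A \<le> measure \<mu> A \<and> measure \<mu> A \<le> real k * measure \<nu> A)"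
proof -
  have ultra: "is_ultrafilter F" using assms(5) by (simp add: nonproper_ultrafilter_def)
  then have F: "F \<noteq> bot" by (simp add: is_ultrafilter_def)
  have \<mu>: "regular_borel_prob X \<mu>" and \<nu>: "regular_borel_prob X \<nu>"
    using assms(6,7) by (auto simp: complexity_measure_def dual_complexity_measure_def)
  obtain A where A: "\<And>\<epsilon>. \<epsilon> > 0 \<Longrightarrow> optimal_separated X \<epsilon> (A \<epsilon>)"
      "\<And>\<phi>. continuous_on X \<phi> \<Longrightarrow> complexity_functional X E F A \<phi> = (\<integral>x. \<phi> x \<partial>\<mu>)"
    using assms(6) unfolding complexity_measure_def by blast
  obtain N where N: "\<And>\<epsilon>. \<epsilon> > 0 \<Longrightarrow> optimal_net X \<epsilon> (N \<epsilon>)"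
      "\<And>\<phi>. continuous_on X \<phi> \<Longrightarrow> dual_complexity_functional X E F N \<phi> = (\<integral>x. \<phi> x \<partial>\<nu>)"
    using assms(7) unfolding dual_complexity_measure_def by blast
  define P where "P n = A (E n)" for n
  define Q where "Q n = N (E n)" for n
  have P: "P n \<subseteq> X" "finite (P n)" "separated (E n) (P n)" "card (P n) = sep_number (E n) X"
      "eps_net X (E n) (P n)" for n
    using A(1)[OF assms(3), of n] optimal_separated_is_net[OF assms(1) assms(3) A(1)[OF assms(3)], of n]
    by (auto simp: P_def optimal_separated_def)
  have Q: "optimal_net X (E n) (Q n)" "Q n \<subseteq> X" "finite (Q n)" "eps_net X (E n) (Q n)"
      "card (Q n) = net_number X (E n)" for n
    using N(1)[OF assms(3), of n] by (auto simp: Q_def optimal_net_def eps_net_def)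
  have limP: "((\<lambda>n. (1 / real (card (P n))) * (\<Sum>x\<in>P n. \<phi> x)) \<longlongrightarrow> (\<integral>x. \<phi> x \<partial>\<mu>)) F"
    if "continuous_on X \<phi>" for \<phi>
    using tendsto_Lim_averages[of X F \<phi> P, OF assms(1) ultra that P(1)] A(2)[OF that]
    by (simp add: complexity_functional_def P(4) P_def[symmetric])
  have limQ: "((\<lambda>n. (1 / real (card (Q n))) * (\<Sum>x\<in>Q n. \<phi> x)) \<longlongrightarrow> (\<integral>x. \<phi> x \<partial>\<nu>)) F"
    if "continuous_on X \<phi>" for \<phi>
    using tendsto_Lim_averages[of X F \<phi> Q, OF assms(1) ultra that Q(2)] N(2)[OF that]
    by (simp add: dual_complexity_functional_def Q(5) Q_def[symmetric])
  have pos: "card (P n) > 0" "card (Q n) > 0" for n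
    using P(2,5)[of n] Q(3,4)[of n] assms(2) by (auto simp: card_gt_0_iff eps_net_def O_nbhd_def)
  have QP: "card (Q n) \<le> card (P n)" for n
    using net_number_le_card[OF P(2,5)] Q(5) by simp
  have small: "eventually (\<lambda>n. E n < \<delta>) F" if "\<delta> > 0" for \<delta>
    using order_tendstoD(2)[OF assms(4) that] nonproper_ultrafilter_le_sequentially[OF assms(5)]
    by (rule filter_leD[rotated])
  obtain \<epsilon>0 where \<epsilon>0: "\<epsilon>0 > 0"
      "\<And>x \<epsilon>. x \<in> X \<Longrightarrow> 0 < \<epsilon> \<Longrightarrow> \<epsilon> < \<epsilon>0 \<Longrightarrow> sep_number \<epsilon> (O_ball X \<epsilon> x) \<le> k"
    using assms(8) by blast
  have count: "card (P n \<inter> S) \<le> k * card {y \<in> Q n. \<exists>x\<in>S. dist x y < E n}" if "E n < \<epsilon>0" for n S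
    using \<epsilon>0(2)[OF _ assms(3) that]
    by (intro card_separated_le_net[OF assms(1,3) P(1-3) Q(3,4)])
  have PQ: "card (P n) \<le> k * card (Q n)" if "E n < \<epsilon>0" for n
  proof -
    have "card (P n) \<le> k * card {y \<in> Q n. \<exists>x\<in>UNIV. dist x y < E n}"
      using count[OF that, of UNIV] by simp
    also have "\<dots> \<le> k * card (Q n)" using Q(3) by (intro mult_left_mono card_mono) auto
    finally show ?thesis .
  qed
  have sets: "sets \<mu> = sets (restrict_space borel X)" "sets \<nu> = sets (restrict_space borel X)"
    using \<mu> \<nu> by (simp_all add: regular_borel_prob_def)
  have le1: "measure \<mu> B \<le> real k * measure \<nu> B" if "B \<in> sets \<mu>" for B
  proof (rule measure_le_if_counting_le[OF \<mu> \<nu> F _ limP limQ P(2) Q(3) _ that])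
    fix S \<delta> assume "(\<delta>::real) > 0"
    \<comment> \<open>The factor \<open>k\<close> comes from the local count; the normalisations only help, since \<open>R \<le> C\<close>.\<close>
    show "eventually (\<lambda>n. real (card (P n \<inter> S)) / real (card (P n))
        \<le> real k * (real (card {y \<in> Q n. \<exists>x\<in>S. dist x y < \<delta>}) / real (card (Q n)))) F"
      using small[OF \<epsilon>0(1)] small[OF \<open>\<delta> > 0\<close>]
    proof eventually_elim
      case (elim n)
      have "card (P n \<inter> S) \<le> k * card {y \<in> Q n. \<exists>x\<in>S. dist x y < E n}"
        by (rule count[OF elim(1)])
      also have "\<dots> \<le> k * card {y \<in> Q n. \<exists>x\<in>S. dist x y < \<delta>}"
        using Q(3) elim(2) by (intro mult_left_mono card_mono) force+
      finally have "real (card (P n \<inter> S)) \<le> real k * real (card {y \<in> Q n. \<exists>x\<in>S. dist x y < \<delta>})"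
        by (simp only: of_nat_le_iff flip: of_nat_mult)
      then have "real (card (P n \<inter> S)) / real (card (P n))
          \<le> real k * real (card {y \<in> Q n. \<exists>x\<in>S. dist x y < \<delta>}) / real (card (Q n))"
        using pos[of n] QP[of n] by (intro frac_le) auto
      then show ?case by simp
    qed
  qed simp_all
  have le2: "measure \<nu> B \<le> real k * measure \<mu> B" if "B \<in> sets \<nu>" for B
  proof (rule measure_le_if_counting_le[OF \<nu> \<mu> F _ limQ limP Q(3) P(2) _ that])
    fix S \<delta> assume "(\<delta>::real) > 0"
    then have "\<delta> / 2 > 0" by simp
    \<comment> \<open>The local count has no factor here; \<open>k\<close> comes from the normalisations, since \<open>C \<le> k R\<close>.\<close>
    show "eventually (\<lambda>n. real (card (Q n \<inter> S)) / real (card (Q n))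
        \<le> real k * (real (card {y \<in> P n. \<exists>x\<in>S. dist x y < \<delta>}) / real (card (P n)))) F"
      using small[OF \<epsilon>0(1)] small[OF \<open>\<delta> / 2 > 0\<close>]
    proof eventually_elim
      case (elim n)
      have "card (Q n \<inter> S) \<le> card {y \<in> P n. \<exists>x\<in>S. dist x y < 2 * E n}"
        by (rule card_optimal_net_le_net[OF Q(1) P(2,5)])
      also have "\<dots> \<le> card {y \<in> P n. \<exists>x\<in>S. dist x y < \<delta>}"
        using P(2) elim(2) by (intro card_mono) force+
      finally have "real (card (Q n \<inter> S)) * real (card (P n))
          \<le> real (card {y \<in> P n. \<exists>x\<in>S. dist x y < \<delta>}) * (real k * real (card (Q n)))"
        using PQ[OF elim(1)] by (intro mult_mono) (auto simp flip: of_nat_mult)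
      then show ?case using pos[of n] by (simp add: field_simps)
    qed
  qed simp_all
  interpret \<mu>: prob_space \<mu> using \<mu> by (simp add: regular_borel_prob_def)
  interpret \<nu>: prob_space \<nu> using \<nu> by (simp add: regular_borel_prob_def)
  have "sets \<mu> = sets \<nu>" using sets by simp
  have "measure \<mu> B = 0 \<longleftrightarrow> measure \<nu> B = 0" if "B \<in> sets \<mu>" for B
    using le1[OF that] le2[of B] that \<open>sets \<mu> = sets \<nu>\<close>
      measure_nonneg[of \<mu> B] measure_nonneg[of \<nu> B] by (metis mult_zero_right order_antisym)
  then have "equivalent_measures \<mu> \<nu>"
    using \<open>sets \<mu> = sets \<nu>\<close>
    by (auto simp: equivalent_measures_def null_sets_def \<mu>.emeasure_eq_measure \<nu>.emeasure_eq_measure)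
  moreover have "1 / real k * measure \<nu> B \<le> measure \<mu> B \<and> measure \<mu> B \<le> real k * measure \<nu> B"
    if "B \<in> sets borel" "B \<subseteq> X" for B
  proof -
    have "B = X \<inter> B" using that(2) by auto
    then have "B \<in> sets (restrict_space borel X)" using that(1) unfolding sets_restrict_space by blast
    then have "measure \<mu> B \<le> real k * measure \<nu> B" "measure \<nu> B \<le> real k * measure \<mu> B"
      using le1[of B] le2[of B] sets by simp_all
    \<comment> \<open>Division by zero yields \<open>0\<close>, so the bound also holds formally for \<open>k = 0\<close>.\<close>
    moreover from this(2) have "1 / real k * measure \<nu> B \<le> measure \<mu> B"
      by (cases "k = 0") (simp_all add: pos_divide_le_eq mult.commute)
    ultimately show ?thesis by simp
  qed
  ultimately show ?thesis by blast
qed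

end
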